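(* Let $G=(V,E)$ be a finite directed graph with propagation probabilities $\Pr[e]\in(0,1]$ for $e\in E$, and let $S_r\subseteq V$ be the seed set of the misinformation. Let $\mathcal{P}$ be an R-sample produced by the hybrid sampling procedure. Then for each $S\subseteq V$, \[\mathbb{E}[x(\mathcal{P},S)]=f^*(S).\]
   Context: **Diffusion model.** Each edge $e\in E$ is independently live with probability $\Pr[e]$ and not live otherwise. A full-realization $g$ fixes the state of every edge; it is identified with the subgraph of $G$ formed by its live edges. Given $g$ and a seed set $S\subseteq V$ of the positive cascade $C_p$, the diffusion is deterministic and proceeds in rounds: at time $0$ nodes in $S_r$ are $C_r$-active (misinformation) and nodes in $S\setminus S_r$ are $C_p$-active; at time $t+1$ every still inactive node having a live incoming edge from a node that became active at time $t$ becomes active, and it becomes $C_r$-active if at least one such in-neighbor is $C_r$-active, and $C_p$-active otherwise. Active nodes never change state. $f(S)$ is the expected (over the random realization) number of nodes that never become $C_r$-active, and $f^*(S):=f(S)-f(\emptyset)$. **R-sample (hybrid sampling).** One R-sample $\mathcal{P}$ is a random finite family (with multiplicity) of subsets of $V$ generated as follows. Each edge's state is sampled at most once during the whole procedure (live with probability $\Pr[e]$, independently), and a sampled state is kept afterwards. (1) Forward step: simulate the diffusion of the misinformation from $S_r$ without positive cascade, sampling edge states as needed; let $V_r$ be the set of $C_r$-active nodes at termination. (2) Reverse step: for each $v\in V_r$, in an arbitrary order, compute a set $P\subseteq V$ and add it to $\mathcal{P}$: start with $P^*=\{v\}$, $P=\emptyset$; repeat: if $P^*\cap S_r\ne\emptyset$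 stop and return $P$; else set $P\leftarrow P\cup P^*$, let $E^*$ be the set of edges $(u_1,u_2)\in E$ with $u_2\in P^*$ and $u_1\in V\setminus P$, and replace $P^*$ by the set of all $u_1$ such that some $(u_1,u_2)\in E^*$ is live (sampling the states of edges in $E^*$ not yet sampled). For $V_1,V_2\subseteq V$, $y(V_1,V_2)=1$ if $V_1\cap V_2\neq\emptyset$ and $0$ otherwise; $x(\mathcal{P},S):=\sum_{P\in\mathcal{P}}y(P,S)$ (counted with multiplicity). *)

theory Defs
  imports "HOL-Probability.Probability" "Graph_Theory.Pair_Digraph"
begin

text \<open>
  Graphs are library digraphs without parallel arcs: \<open>pverts G\<close> is \<open>V\<close> and
  \<open>parcs G\<close> is \<open>E\<close>. Loops are allowed.
\<close>

section \<open>The diffusion model\<close>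

definition realization_pmf ::
  "'v pair_pre_digraph \<Rightarrow> ('v \<times> 'v \<Rightarrow> real) \<Rightarrow> ('v \<times> 'v) set pmf" where
  "realization_pmf G p =
     map_pmf (\<lambda>s. {e \<in> parcs G. s e}) (Pi_pmf (parcs G) False (\<lambda>e. bernoulli_pmf (p e)))"

datatype status = Inactive | Misinformed | Protected

text \<open>
  A configuration \<open>(st, N)\<close> consists of the status of all nodes at some time and the set \<open>N\<close> of
  those nodes that became active exactly at that time.
\<close>

type_synonym 'v configuration = "('v \<Rightarrow> status) \<times> 'v set"

definition initial_configuration :: "'v set \<Rightarrow> 'v set \<Rightarrow> 'v configuration" where
  "initial_configuration Sr S =
     ((\<lambda>v. if v \<in> Sr then Misinformed else if v \<in> S then Protected else Inactive), Sr \<union> S)"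

fun diffusion_step :: "('v \<times> 'v) set \<Rightarrow> 'v configuration \<Rightarrow> 'v configuration" where
  "diffusion_step g (st, N) =
     (let N' = {v. st v = Inactive \<and> (\<exists>u\<in>N. (u, v) \<in> g)} in
       ((\<lambda>v. if v \<in> N'
             then (if \<exists>u\<in>N. (u, v) \<in> g \<and> st u = Misinformed then Misinformed else Protected)
             else st v),
        N'))"

definition diffusion ::
  "('v \<times> 'v) set \<Rightarrow> 'v set \<Rightarrow> 'v set \<Rightarrow> nat \<Rightarrow> 'v configuration" where
  "diffusion g Sr S t = (diffusion_step g ^^ t) (initial_configuration Sr S)"

definition never_misinformed ::
  "'v pair_pre_digraph \<Rightarrow> ('v \<times> 'v) set \<Rightarrow> 'v set \<Rightarrow> 'v set \<Rightarrow> 'v set" where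
  "never_misinformed G g Sr S =
     {v \<in> pverts G. \<forall>t. fst (diffusion g Sr S t) v \<noteq> Misinformed}"

definition f_val ::
  "'v pair_pre_digraph \<Rightarrow> ('v \<times> 'v \<Rightarrow> real) \<Rightarrow> 'v set \<Rightarrow> 'v set \<Rightarrow> real" where
  "f_val G p Sr S =
     measure_pmf.expectation (realization_pmf G p) (\<lambda>g. real (card (never_misinformed G g Sr S)))"

definition f_star ::
  "'v pair_pre_digraph \<Rightarrow> ('v \<times> 'v \<Rightarrow> real) \<Rightarrow> 'v set \<Rightarrow> 'v set \<Rightarrow> real" where
  "f_star G p Sr S = f_val G p Sr S - f_val G p Sr {}"

section \<open>Hybrid sampling\<close>

text \<open>
  The sampling procedure is a probabilistic program whose memory holds the edge states sampled so
  far (\<open>None\<close> for an edge that has not been sampled). \<open>sample_edges p D m\<close> samples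
  the edges in \<open>D\<close> that have no state yet and leaves all known states unchanged.
\<close>

type_synonym 'v edge_states = "'v \<times> 'v \<Rightarrow> bool option"

definition sample_edges ::
  "('v \<times> 'v \<Rightarrow> real) \<Rightarrow> ('v \<times> 'v) set \<Rightarrow> 'v edge_states \<Rightarrow> 'v edge_states spmf" where
  "sample_edges p D m = spmf_of_pmf
     (map_pmf (\<lambda>s e. if e \<in> D - dom m then Some (s e) else m e)
       (Pi_pmf (D - dom m) False (\<lambda>e. bernoulli_pmf (p e))))"

definition live_edges :: "'v edge_states \<Rightarrow> ('v \<times> 'v) set" where
  "live_edges m = {e. m e = Some True}"

text \<open>
  The two loops are unbounded, hence live in the monad of discrete subprobability distributions,
  where a diverging run carries no mass. Lemma \<open>lossless_r_sample\<close> below shows that the whole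
  procedure terminates almost surely, so that it yields a proper distribution.
\<close>

text \<open>
  In each round, the states needed to perform the next diffusion step are those of the edges from
  newly active to inactive nodes. The result is \<open>V\<^sub>r\<close> and the memory.
\<close>

partial_function (spmf) forward_loop ::
  "'v pair_pre_digraph \<Rightarrow> ('v \<times> 'v \<Rightarrow> real) \<Rightarrow> 'v configuration \<Rightarrow> 'v edge_states \<Rightarrow>
   ('v set \<times> 'v edge_states) spmf" where
  "forward_loop G p c m =
     (if snd c = {} then return_spmf ({v \<in> pverts G. fst c v = Misinformed}, m)
      else do {
        m' \<leftarrow> sample_edges p {(u, v) \<in> parcs G. u \<in> snd c \<and> fst c v = Inactive} m;
        forward_loop G p (diffusion_step (live_edges m') c) m'
      })"

definition forward_sample ::
  "'v pair_pre_digraph \<Rightarrow> ('v \<times> 'v \<Rightarrow> real) \<Rightarrow> 'v set \<Rightarrow> ('v set \<times> 'v edge_states) spmf" where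
  "forward_sample G p Sr = forward_loop G p (initial_configuration Sr {}) Map.empty"

text \<open>\<open>Q\<close> is the frontier \<open>P\<^sup>*\<close>.\<close>

partial_function (spmf) reverse_loop ::
  "'v pair_pre_digraph \<Rightarrow> ('v \<times> 'v \<Rightarrow> real) \<Rightarrow> 'v set \<Rightarrow> 'v set \<Rightarrow> 'v set \<Rightarrow> 'v edge_states \<Rightarrow>
   ('v set \<times> 'v edge_states) spmf" where
  "reverse_loop G p Sr Q P m =
     (if Q \<inter> Sr \<noteq> {} then return_spmf (P, m)
      else
        let P' = P \<union> Q;
            D = {(u1, u2) \<in> parcs G. u2 \<in> Q \<and> u1 \<in> pverts G - P'}
        in do {
          m' \<leftarrow> sample_edges p D m;
          reverse_loop G p Sr {u1. \<exists>u2. (u1, u2) \<in> D \<and> (u1, u2) \<in> live_edges m'} P' m'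
        })"

primrec reverse_samples ::
  "'v pair_pre_digraph \<Rightarrow> ('v \<times> 'v \<Rightarrow> real) \<Rightarrow> 'v set \<Rightarrow> 'v list \<Rightarrow> 'v edge_states \<Rightarrow>
   'v set multiset spmf" where
  "reverse_samples G p Sr [] m = return_spmf {#}"
| "reverse_samples G p Sr (v # vs) m = do {
     (P, m') \<leftarrow> reverse_loop G p Sr {v} {} m;
     Ps \<leftarrow> reverse_samples G p Sr vs m';
     return_spmf (add_mset P Ps)
   }"

text \<open>
  \<open>ord A m\<close> lists the nodes of \<open>A = V\<^sub>r\<close> in the order in which the reverse step
  processes them; the order may depend on the edge states \<open>m\<close> sampled by the forward step.
\<close>

definition processing_order ::
  "'v pair_pre_digraph \<Rightarrow> ('v set \<Rightarrow> 'v edge_states \<Rightarrow> 'v list) \<Rightarrow> bool" where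
  "processing_order G ord \<longleftrightarrow> (\<forall>A m. A \<subseteq> pverts G \<longrightarrow> set (ord A m) = A \<and> distinct (ord A m))"

definition r_sample ::
  "'v pair_pre_digraph \<Rightarrow> ('v \<times> 'v \<Rightarrow> real) \<Rightarrow> 'v set \<Rightarrow> ('v set \<Rightarrow> 'v edge_states \<Rightarrow> 'v list) \<Rightarrow>
   'v set multiset spmf" where
  "r_sample G p Sr ord = do {
     (Vr, m) \<leftarrow> forward_sample G p Sr;
     reverse_samples G p Sr (ord Vr m) m
   }"

definition y_ind :: "'v set \<Rightarrow> 'v set \<Rightarrow> real" where
  "y_ind V1 V2 = (if V1 \<inter> V2 \<noteq> {} then 1 else 0)"

definition x_cover :: "'v set multiset \<Rightarrow> 'v set \<Rightarrow> real" where
  "x_cover Ps S = (\<Sum>P\<in>#Ps. y_ind P S)"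

section \<open>Termination of the sampling procedure\<close>

lemma set_sample_edges:
  assumes "m' \<in> set_spmf (sample_edges p D m)"
  shows "\<And>e. e \<in> dom m \<Longrightarrow> m' e = m e"
    and "\<And>e. e \<in> D \<Longrightarrow> e \<in> dom m'"
    and "\<And>e. e \<notin> D \<Longrightarrow> m' e = m e"
  using assms by (auto simp: sample_edges_def dom_def split: if_splits)

lemma lossless_sample_edges [simp]: "lossless_spmf (sample_edges p D m)"
  by (simp add: sample_edges_def)

lemma live_edges_sample_mono:
  assumes "m' \<in> set_spmf (sample_edges p D m)"
  shows "live_edges m \<subseteq> live_edges m'"
  using set_sample_edges(1)[OF assms] by (fastforce simp: live_edges_def dom_def)

lemma live_edges_sample_subset:
  assumes "m' \<in> set_spmf (sample_edges p D m)" "D \<subseteq> E" "live_edges m \<subseteq> E"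
  shows "live_edges m' \<subseteq> E"
proof
  fix e assume "e \<in> live_edges m'"
  then show "e \<in> E"
    using set_sample_edges(3)[OF assms(1), of e] assms(2,3)
    by (cases "e \<in> D") (auto simp: live_edges_def)
qed

lemma forward_loop_terminates:
  assumes G: "pair_fin_digraph G"
  shows "live_edges m \<subseteq> parcs G \<Longrightarrow> snd c \<subseteq> {v. fst c v \<noteq> Inactive} \<Longrightarrow>
    {v. fst c v \<noteq> Inactive} \<subseteq> (live_edges m)\<^sup>* `` Sr \<Longrightarrow>
    lossless_spmf (forward_loop G p c m) \<and>
    (\<forall>(A, m') \<in> set_spmf (forward_loop G p c m).
       A \<subseteq> pverts G \<and> live_edges m' \<subseteq> parcs G \<and> A \<subseteq> (live_edges m')\<^sup>* `` Sr)"
proof (induction "(\<lambda>c. card {v \<in> pverts G. fst c v = Inactive} + (if snd c = {} then 0 else 1)) c"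
    arbitrary: c m rule: less_induct)
  case less
  interpret pair_fin_digraph G by (rule G)
  show ?case
  proof (cases "snd c = {}")
    case True
    then show ?thesis
      using less.prems by (subst (1 2) forward_loop.simps) auto
  next
    case False
    obtain st N where c: "c = (st, N)" by force
    define D where "D = {(u, v) \<in> parcs G. u \<in> snd c \<and> fst c v = Inactive}"
    have IH: "lossless_spmf (forward_loop G p (diffusion_step (live_edges m') c) m') \<and>
      (\<forall>(A, m'') \<in> set_spmf (forward_loop G p (diffusion_step (live_edges m') c) m').
         A \<subseteq> pverts G \<and> live_edges m'' \<subseteq> parcs G \<and> A \<subseteq> (live_edges m'')\<^sup>* `` Sr)"
      if m': "m' \<in> set_spmf (sample_edges p D m)" for m'
    proof (rule less.hyps)
      define N' where "N' = {v. st v = Inactive \<and> (\<exists>u\<in>N. (u, v) \<in> live_edges m')}"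
      define st' where "st' = fst (diffusion_step (live_edges m') c)"
      have step: "diffusion_step (live_edges m') c = (st', N')"
        by (simp add: st'_def c N'_def Let_def)
      have act: "st' v \<noteq> Inactive \<longleftrightarrow> st v \<noteq> Inactive \<or> v \<in> N'" for v
        by (auto simp: st'_def c N'_def Let_def)
      show sub: "live_edges m' \<subseteq> parcs G"
        by (rule live_edges_sample_subset[OF m' _ less.prems(1)]) (auto simp: D_def)
      have mono: "(live_edges m)\<^sup>* \<subseteq> (live_edges m')\<^sup>*"
        by (rule rtrancl_mono) (rule live_edges_sample_mono[OF m'])
      have NV: "N' \<subseteq> {v \<in> pverts G. st v = Inactive}"
        using sub by (auto simp: N'_def dest: in_arcsD2)
      show "snd (diffusion_step (live_edges m') c)
          \<subseteq> {v. fst (diffusion_step (live_edges m') c) v \<noteq> Inactive}"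
        by (auto simp: step act)
      show "{v. fst (diffusion_step (live_edges m') c) v \<noteq> Inactive}
          \<subseteq> (live_edges m')\<^sup>* `` Sr"
      proof
        fix v assume "v \<in> {v. fst (diffusion_step (live_edges m') c) v \<noteq> Inactive}"
        then consider "st v \<noteq> Inactive" | u where "u \<in> N" "(u, v) \<in> live_edges m'"
          by (auto simp: step act N'_def)
        then show "v \<in> (live_edges m')\<^sup>* `` Sr"
        proof cases
          case 1
          then show ?thesis using less.prems(3) mono by (auto simp: c)
        next
          case 2
          then have "u \<in> (live_edges m)\<^sup>* `` Sr"
            using less.prems(2,3) unfolding c by (metis (mono_tags) fst_conv snd_conv subsetD)
          then have "u \<in> (live_edges m')\<^sup>* `` Sr"
            using mono by blast
          with 2 show ?thesis by (auto intro: rtrancl_into_rtrancl)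
        qed
      qed
      have eq: "{v \<in> pverts G. st' v = Inactive} = {v \<in> pverts G. st v = Inactive} - N'"
        using act by blast
      show "card {v \<in> pverts G. fst (diffusion_step (live_edges m') c) v = Inactive} +
          (if snd (diffusion_step (live_edges m') c) = {} then 0 else 1)
        < card {v \<in> pverts G. fst c v = Inactive} + (if snd c = {} then 0 else 1)"
      proof (cases "N' = {}")
        case True
        then show ?thesis using False eq unfolding step by (simp add: c)
      next
        case ne: False
        have "card ({v \<in> pverts G. st v = Inactive} - N') < card {v \<in> pverts G. st v = Inactive}"
          using ne NV pair_finite_verts by (intro psubset_card_mono) auto
        then show ?thesis using False eq ne unfolding step by (simp add: c)
      qed
    qed
    have "forward_loop G p c m = do {
        m' \<leftarrow> sample_edges p D m;
        forward_loop G p (diffusion_step (live_edges m') c) m' }"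
      using False by (subst forward_loop.simps) (simp add: D_def)
    then show ?thesis
      using IH by (fastforce simp: set_bind_spmf)
  qed
qed

lemma reverse_loop_terminates:
  assumes G: "pair_fin_digraph G" and v: "v \<in> pverts G"
  shows "live_edges m \<subseteq> parcs G \<Longrightarrow> v \<in> (live_edges m)\<^sup>* `` Sr \<Longrightarrow>
    v \<in> P \<union> Q \<Longrightarrow> P \<inter> Q = {} \<Longrightarrow> P \<inter> Sr = {} \<Longrightarrow> Q \<subseteq> pverts G \<Longrightarrow>
    (\<forall>(a, b) \<in> parcs G. b \<in> P \<longrightarrow> a \<notin> P \<longrightarrow>
       m (a, b) \<noteq> None \<and> (m (a, b) = Some True \<longrightarrow> a \<in> Q)) \<Longrightarrow>
    lossless_spmf (reverse_loop G p Sr Q P m) \<and>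
    (\<forall>(A, m') \<in> set_spmf (reverse_loop G p Sr Q P m).
       live_edges m' \<subseteq> parcs G \<and> live_edges m \<subseteq> live_edges m')"
proof (induction "card (pverts G - P)" arbitrary: Q P m rule: less_induct)
  case less
  interpret pair_fin_digraph G by (rule G)
  show ?case
  proof (cases "Q \<inter> Sr = {}")
    case False
    then show ?thesis
      using less.prems by (subst (1 2) reverse_loop.simps) auto
  next
    case True
    define P' where "P' = P \<union> Q"
    define D where "D = {(u1, u2) \<in> parcs G. u2 \<in> Q \<and> u1 \<in> pverts G - P'}"
    define Q' where "Q' m' = {u1. \<exists>u2. (u1, u2) \<in> D \<and> (u1, u2) \<in> live_edges m'}" for m'
    have "Q \<noteq> {}"
    proof
      assume Q: "Q = {}"
      from less.prems(2) obtain s where s: "s \<in> Sr" "(s, v) \<in> (live_edges m)\<^sup>*" by blast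
      have "x \<in> P" if "(x, v) \<in> (live_edges m)\<^sup>*" for x
        using that
      proof (induction rule: converse_rtrancl_induct)
        case base
        then show ?case using less.prems(3) Q by simp
      next
        case (step a b)
        then show ?case using less.prems(1,7) Q by (fastforce simp: live_edges_def)
      qed
      with s less.prems(5) show False by blast
    qed
    then have less_card: "card (pverts G - P') < card (pverts G - P)"
      using less.prems(4,6) pair_finite_verts
      by (intro psubset_card_mono) (auto simp: P'_def)
    have IH: "lossless_spmf (reverse_loop G p Sr (Q' m') P' m') \<and>
      (\<forall>(A, m'') \<in> set_spmf (reverse_loop G p Sr (Q' m') P' m').
         live_edges m'' \<subseteq> parcs G \<and> live_edges m' \<subseteq> live_edges m'')"
      if m': "m' \<in> set_spmf (sample_edges p D m)" for m'
    proof (rule less.hyps[OF less_card])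
      show "live_edges m' \<subseteq> parcs G"
        by (rule live_edges_sample_subset[OF m' _ less.prems(1)]) (auto simp: D_def)
      have "(live_edges m)\<^sup>* \<subseteq> (live_edges m')\<^sup>*"
        by (rule rtrancl_mono) (rule live_edges_sample_mono[OF m'])
      then show "v \<in> (live_edges m')\<^sup>* `` Sr" using less.prems(2) by blast
      show "v \<in> P' \<union> Q' m'" using less.prems(3) by (auto simp: P'_def)
      show "P' \<inter> Q' m' = {}" by (auto simp: Q'_def D_def)
      show "P' \<inter> Sr = {}" using less.prems(5) True by (auto simp: P'_def)
      show "Q' m' \<subseteq> pverts G" by (auto simp: Q'_def D_def)
      show "\<forall>(a, b) \<in> parcs G. b \<in> P' \<longrightarrow> a \<notin> P' \<longrightarrow>
         m' (a, b) \<noteq> None \<and> (m' (a, b) = Some True \<longrightarrow> a \<in> Q' m')"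
      proof (clarify, intro conjI impI)
        fix a b assume ab: "(a, b) \<in> parcs G" "b \<in> P'" "a \<notin> P'"
        have old: "m (a, b) = Some False" if "b \<notin> Q"
          using that ab less.prems(7) by (fastforce simp: P'_def)
        have new: "(a, b) \<in> D" if "b \<in> Q"
          using that ab by (auto simp: D_def dest: in_arcsD1)
        show "m' (a, b) \<noteq> None"
          using old new set_sample_edges(1,2)[OF m', of "(a, b)"] by (cases "b \<in> Q") auto
        show "a \<in> Q' m'" if "m' (a, b) = Some True"
          using that old new set_sample_edges(1)[OF m', of "(a, b)"]
          by (cases "b \<in> Q") (auto simp: Q'_def live_edges_def)
      qed
    qed
    have "reverse_loop G p Sr Q P m = do {
        m' \<leftarrow> sample_edges p D m;
        reverse_loop G p Sr (Q' m') P' m' }"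
      using True by (subst reverse_loop.simps) (simp add: P'_def D_def Q'_def Let_def)
    then show ?thesis
      using IH live_edges_sample_mono[of _ p D m] by (fastforce simp: set_bind_spmf)
  qed
qed

lemma lossless_reverse_samples:
  assumes G: "pair_fin_digraph G"
  shows "live_edges m \<subseteq> parcs G \<Longrightarrow> set vs \<subseteq> pverts G \<Longrightarrow>
    set vs \<subseteq> (live_edges m)\<^sup>* `` Sr \<Longrightarrow> lossless_spmf (reverse_samples G p Sr vs m)"
proof (induction vs arbitrary: m)
  case (Cons v vs)
  have 1: "lossless_spmf (reverse_loop G p Sr {v} {} m) \<and>
    (\<forall>(A, m') \<in> set_spmf (reverse_loop G p Sr {v} {} m).
       live_edges m' \<subseteq> parcs G \<and> live_edges m \<subseteq> live_edges m')"
    using Cons.prems by (intro reverse_loop_terminates[OF G, of v]) auto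
  have "lossless_spmf (reverse_samples G p Sr vs m')"
    if "(A, m') \<in> set_spmf (reverse_loop G p Sr {v} {} m)" for A m'
  proof (rule Cons.IH)
    have *: "live_edges m' \<subseteq> parcs G" "live_edges m \<subseteq> live_edges m'"
      using 1 that by auto
    then show "live_edges m' \<subseteq> parcs G" by simp
    show "set vs \<subseteq> pverts G" using Cons.prems(2) by simp
    show "set vs \<subseteq> (live_edges m')\<^sup>* `` Sr"
      using Cons.prems(3) rtrancl_mono[OF *(2)] by fastforce
  qed
  with 1 show ?case by (auto split: prod.split)
qed simp

lemma lossless_r_sample:
  assumes G: "pair_fin_digraph G" and ord: "processing_order G ord"
  shows "lossless_spmf (r_sample G p Sr ord)"
proof -
  have 1: "lossless_spmf (forward_sample G p Sr) \<and>
    (\<forall>(A, m') \<in> set_spmf (forward_sample G p Sr).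
       A \<subseteq> pverts G \<and> live_edges m' \<subseteq> parcs G \<and> A \<subseteq> (live_edges m')\<^sup>* `` Sr)"
    unfolding forward_sample_def
    by (rule forward_loop_terminates[OF G]) (auto simp: live_edges_def initial_configuration_def)
  have "lossless_spmf (reverse_samples G p Sr (ord A m) m)"
    if "(A, m) \<in> set_spmf (forward_sample G p Sr)" for A m
  proof -
    have *: "A \<subseteq> pverts G" "live_edges m \<subseteq> parcs G" "A \<subseteq> (live_edges m)\<^sup>* `` Sr"
      using 1 that by auto
    then have "set (ord A m) = A" using ord by (simp add: processing_order_def)
    with * show ?thesis by (intro lossless_reverse_samples[OF G]) simp_all
  qed
  with 1 show ?thesis by (auto simp: r_sample_def split: prod.split)
qed

end

theory Submission
  imports Defs
begin

text \<open>
  In a fixed realization, a node \<open>v\<close> reachable from \<open>S\<^sub>r\<close> is misinformed under \<open>S\<close> iff no node of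
  \<open>S\<close> has a smaller distance to \<open>v\<close> than \<open>S\<^sub>r\<close>. The reverse step from \<open>v\<close> collects exactly the nodes
  with a smaller distance to \<open>v\<close> than \<open>S\<^sub>r\<close>, so it hits \<open>S\<close> iff \<open>S\<close> saves \<open>v\<close>. It remains to see that
  the sets produced by the sampling procedure are distributed like those computed from a full
  realization. By the principle of deferred decisions, sampling all edges still unknown at the end
  of a loop gives the same law as sampling all of them at the beginning, and the result of a loop
  is a function of any full realization extending its final memory.
\<close>

section \<open>Distances in a realization\<close>

text \<open>\<open>A n\<close> and \<open>B n\<close> collect the ends of walks of length exactly n
  from \<open>Sr\<close> and \<open>S\<close>, so a node is activated at its distance from their
  union. As ties favour misinformation, it becomes misinformed iff some shortest such walk starts in
  \<open>Sr\<close>. The induction is simultaneous because a round reads both the statuses and the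
  newly active nodes.\<close>

lemma diffusion_characterization:
  fixes g :: "('v \<times> 'v) set" and Sr S :: "'v set"
  defines "A \<equiv> \<lambda>n. (g ^^ n) `` Sr" and "B \<equiv> \<lambda>n. (g ^^ n) `` S"
  shows "(\<forall>v. fst (diffusion g Sr S t) v = Inactive \<longleftrightarrow> (\<forall>j\<le>t. v \<notin> A j \<union> B j)) \<and>
    (\<forall>v. fst (diffusion g Sr S t) v = Misinformed \<longleftrightarrow>
      (\<exists>n\<le>t. v \<in> A n \<and> (\<forall>j<n. v \<notin> A j \<union> B j))) \<and>
    snd (diffusion g Sr S t) = {v. v \<in> A t \<union> B t \<and> (\<forall>j<t. v \<notin> A j \<union> B j)}"
proof (induction t)
  case 0
  show ?case
    by (auto simp: diffusion_def initial_configuration_def A_def B_def)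
next
  case (Suc t)
  obtain st N where c: "diffusion g Sr S t = (st, N)" by force
  have inact: "st v = Inactive \<longleftrightarrow> (\<forall>j\<le>t. v \<notin> A j \<union> B j)" for v
    using Suc c by simp
  have mis: "st v = Misinformed \<longleftrightarrow> (\<exists>n\<le>t. v \<in> A n \<and> (\<forall>j<n. v \<notin> A j \<union> B j))" for v
    using Suc c by simp
  have N: "N = {v. v \<in> A t \<union> B t \<and> (\<forall>j<t. v \<notin> A j \<union> B j)}"
    using Suc c by simp
  have A_Suc: "v \<in> A (Suc n) \<longleftrightarrow> (\<exists>u. u \<in> A n \<and> (u, v) \<in> g)" for v n
    by (auto simp: A_def)
  have B_Suc: "v \<in> B (Suc n) \<longleftrightarrow> (\<exists>u. u \<in> B n \<and> (u, v) \<in> g)" for v n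
    by (auto simp: B_def)
  define N' where "N' = {v. st v = Inactive \<and> (\<exists>u\<in>N. (u, v) \<in> g)}"
  \<comment> \<open>An out-neighbour of a node reached before time t is itself reached by time
    t.\<close>
  have early: "u \<notin> A j \<union> B j" if "st v = Inactive" "(u, v) \<in> g" "j < t" for u v j
  proof
    assume "u \<in> A j \<union> B j"
    then have "v \<in> A (Suc j) \<union> B (Suc j)" using that(2) by (auto simp: A_Suc B_Suc)
    then show False using that(1,3) inact[of v] by auto
  qed
  have N': "N' = {v. v \<in> A (Suc t) \<union> B (Suc t) \<and> (\<forall>j<Suc t. v \<notin> A j \<union> B j)}"
  proof (intro set_eqI iffI)
    fix v assume "v \<in> N'"
    then show "v \<in> {v. v \<in> A (Suc t) \<union> B (Suc t) \<and> (\<forall>j<Suc t. v \<notin> A j \<union> B j)}"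
      by (auto simp: N'_def inact N A_Suc B_Suc)
  next
    fix v assume v: "v \<in> {v. v \<in> A (Suc t) \<union> B (Suc t) \<and> (\<forall>j<Suc t. v \<notin> A j \<union> B j)}"
    then have i: "st v = Inactive" by (simp add: inact)
    from v obtain u where u: "u \<in> A t \<union> B t" "(u, v) \<in> g" by (auto simp: A_Suc B_Suc)
    then have "u \<in> N" using early[OF i] by (auto simp: N)
    with i u show "v \<in> N'" by (auto simp: N'_def)
  qed
  have src: "(\<exists>u\<in>N. (u, v) \<in> g \<and> st u = Misinformed) \<longleftrightarrow> v \<in> A (Suc t)"
    if v: "v \<in> N'" for v
  proof
    assume "\<exists>u\<in>N. (u, v) \<in> g \<and> st u = Misinformed"
    then obtain u n where u: "u \<in> N" "(u, v) \<in> g" "n \<le> t" "u \<in> A n"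
      by (auto simp: mis)
    \<comment> \<open>No node of \<open>N\<close> was reached before t, which forces the hit at n
      \<le> t to be at t.\<close>
    then have "n = t" by (auto simp: N order_le_less)
    with u show "v \<in> A (Suc t)" by (auto simp: A_Suc)
  next
    assume "v \<in> A (Suc t)"
    then obtain u where u: "u \<in> A t" "(u, v) \<in> g" by (auto simp: A_Suc)
    moreover have "\<forall>j<t. u \<notin> A j \<union> B j" using early[OF _ u(2)] v by (simp add: N'_def)
    ultimately show "\<exists>u\<in>N. (u, v) \<in> g \<and> st u = Misinformed"
      by (auto simp: N mis)
  qed
  define st' where "st' v = (if v \<in> N'
      then (if \<exists>u\<in>N. (u, v) \<in> g \<and> st u = Misinformed then Misinformed else Protected)
      else st v)" for v
  have step: "diffusion g Sr S (Suc t) = (st', N')"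
  proof -
    have "diffusion g Sr S (Suc t) = diffusion_step g (st, N)"
      unfolding c[symmetric] by (simp add: diffusion_def)
    also have "\<dots> = (st', N')"
      by (simp add: st'_def N'_def Let_def fun_eq_iff)
    finally show ?thesis .
  qed
  have "st' v = Inactive \<longleftrightarrow> (\<forall>j\<le>Suc t. v \<notin> A j \<union> B j)" for v
    using inact[of v] by (auto simp: st'_def N' le_Suc_eq less_Suc_eq_le)
  moreover have "st' v = Misinformed \<longleftrightarrow>
      (\<exists>n\<le>Suc t. v \<in> A n \<and> (\<forall>j<n. v \<notin> A j \<union> B j))" for v
  proof (cases "v \<in> N'")
    case True
    then have "st' v = Misinformed \<longleftrightarrow> v \<in> A (Suc t)" by (simp add: st'_def src)
    with True show ?thesis by (auto simp: N' le_Suc_eq)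
  next
    case False
    then have "st' v = Misinformed \<longleftrightarrow> st v = Misinformed" by (simp add: st'_def)
    with False show ?thesis by (auto simp: N' mis le_Suc_eq)
  qed
  ultimately show ?case by (simp add: step N')
qed

text \<open>Choosing the least n makes the avoidance of earlier visits from \<open>Sr\<close>
  automatic. The remaining condition mentions \<open>S\<close> only negatively, so enlarging
  \<open>S\<close> never misinforms more nodes.\<close>

lemma misinformed_iff:
  "(\<exists>t. fst (diffusion g Sr S t) v = Misinformed) \<longleftrightarrow>
   (\<exists>n. v \<in> (g ^^ n) `` Sr \<and> (\<forall>j<n. v \<notin> (g ^^ j) `` S))" (is "_ = (\<exists>n. ?Q n)")
proof -
  have "(\<exists>t. fst (diffusion g Sr S t) v = Misinformed) \<longleftrightarrow>
      (\<exists>n. v \<in> (g ^^ n) `` Sr \<and> (\<forall>j<n. v \<notin> (g ^^ j) `` Sr \<union> (g ^^ j) `` S))"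
    by (auto simp: diffusion_characterization)
  also have "\<dots> \<longleftrightarrow> (\<exists>n. ?Q n)"
  proof
    assume ex: "\<exists>n. ?Q n"
    define n where "n = (LEAST n. ?Q n)"
    have "?Q n" unfolding n_def using ex by (rule LeastI_ex)
    moreover have "v \<notin> (g ^^ j) `` Sr" if "j < n" for j
      using not_less_Least[OF that[unfolded n_def]] \<open>?Q n\<close> that by auto
    ultimately show "\<exists>n. v \<in> (g ^^ n) `` Sr \<and> (\<forall>j<n. v \<notin> (g ^^ j) `` Sr \<union> (g ^^ j) `` S)"
      by blast
  qed blast
  finally show ?thesis .
qed

section \<open>Nodes saved by \<open>S\<close> in a fixed realization\<close>

definition misinformed_nodes ::
  "'v pair_pre_digraph \<Rightarrow> ('v \<times> 'v) set \<Rightarrow> 'v set \<Rightarrow> 'v set" where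
  "misinformed_nodes G g Sr = {v \<in> pverts G. \<exists>t. fst (diffusion g Sr {} t) v = Misinformed}"

text \<open>After a round without new activations the configuration no longer changes, and
  misinformation persists, so the forward loop may read off the final result there.\<close>

lemma misinformed_nodes_eq:
  assumes "snd (diffusion g Sr {} t) = {}"
  shows "misinformed_nodes G g Sr = {v \<in> pverts G. fst (diffusion g Sr {} t) v = Misinformed}"
proof -
  obtain st where c: "diffusion g Sr {} t = (st, {})"
    using assms by (cases "diffusion g Sr {} t") auto
  have "diffusion g Sr {} (k + t) = (st, {})" for k
    by (induction k) (use c in \<open>auto simp: diffusion_def\<close>)
  then have late: "diffusion g Sr {} s = (st, {})" if "t \<le> s" for s
    using that by (metis le_add_diff_inverse2)
  have mono: "fst (diffusion g Sr {} s) v = Misinformed"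
    if r: "fst (diffusion g Sr {} r) v = Misinformed" and "r \<le> s" for r s v
  proof -
    from r obtain n where "n \<le> r" "v \<in> (g ^^ n) `` Sr"
      "\<forall>j<n. v \<notin> (g ^^ j) `` Sr \<union> (g ^^ j) `` {}"
      by (simp only: diffusion_characterization) blast
    moreover from this(1) \<open>r \<le> s\<close> have "n \<le> s" by (rule order_trans)
    ultimately show ?thesis
      by (simp only: diffusion_characterization) blast
  qed
  have "st v = Misinformed" if "fst (diffusion g Sr {} s) v = Misinformed" for s v
    using mono[OF that, of "max s t"] late[of "max s t"] by simp
  then show ?thesis by (auto simp: misinformed_nodes_def c intro: exI[of _ t])
qed

text \<open>The set that the reverse step from v is to return. The bound j \<le> n, rather than j <
  n, excludes nodes as far from v as \<open>Sr\<close>, since ties favour misinformation.\<close>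

definition closer_nodes :: "('v \<times> 'v) set \<Rightarrow> 'v set \<Rightarrow> 'v \<Rightarrow> 'v set" where
  "closer_nodes g Sr v = {u. \<exists>n. (u, v) \<in> g ^^ n \<and> (\<forall>j\<le>n. v \<notin> (g ^^ j) `` Sr)}"

lemma never_misinformed_iff_closer_nodes:
  assumes "v \<in> misinformed_nodes G g Sr"
  shows "v \<in> never_misinformed G g Sr S \<longleftrightarrow> closer_nodes g Sr v \<inter> S \<noteq> {}"
proof -
  have v: "v \<in> pverts G" and ex: "\<exists>n. v \<in> (g ^^ n) `` Sr"
    using assms by (auto simp: misinformed_nodes_def misinformed_iff)
  have iff: "v \<in> never_misinformed G g Sr S \<longleftrightarrow>
      (\<forall>n. v \<in> (g ^^ n) `` Sr \<longrightarrow> (\<exists>j<n. v \<in> (g ^^ j) `` S))"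
  proof -
    have "v \<in> never_misinformed G g Sr S \<longleftrightarrow>
        \<not> (\<exists>t. fst (diffusion g Sr S t) v = Misinformed)"
      using v by (simp add: never_misinformed_def)
    also have "\<dots> \<longleftrightarrow> (\<forall>n. v \<in> (g ^^ n) `` Sr \<longrightarrow> (\<exists>j<n. v \<in> (g ^^ j) `` S))"
      unfolding misinformed_iff by (simp del: Image_iff Image_singleton_iff)
    finally show ?thesis .
  qed
  show ?thesis
  proof
    assume l: "v \<in> never_misinformed G g Sr S"
    \<comment> \<open>The distance from \<open>Sr\<close> to v, finite because v is misinformed
      without a positive cascade.\<close>
    define n where "n = (LEAST n. v \<in> (g ^^ n) `` Sr)"
    have n: "v \<in> (g ^^ n) `` Sr" unfolding n_def using ex by (rule LeastI_ex)
    have nl: "v \<notin> (g ^^ j) `` Sr" if "j < n" for j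
      using not_less_Least[OF that[unfolded n_def]] .
    from l n obtain j u where "j < n" "u \<in> S" "(u, v) \<in> g ^^ j" unfolding iff by blast
    moreover then have "\<forall>i\<le>j. v \<notin> (g ^^ i) `` Sr" using nl by auto
    ultimately show "closer_nodes g Sr v \<inter> S \<noteq> {}" by (auto simp: closer_nodes_def)
  next
    assume "closer_nodes g Sr v \<inter> S \<noteq> {}"
    then obtain u j where u: "u \<in> S" "(u, v) \<in> g ^^ j" "\<forall>i\<le>j. v \<notin> (g ^^ i) `` Sr"
      by (auto simp: closer_nodes_def)
    show "v \<in> never_misinformed G g Sr S"
      unfolding iff
    proof (intro allI impI)
      fix n assume "v \<in> (g ^^ n) `` Sr"
      with u(3) have "j < n" by (meson not_le_imp_less)
      with u show "\<exists>j<n. v \<in> (g ^^ j) `` S" by blast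
    qed
  qed
qed

text \<open>The theorem before taking expectations. Passing from no positive cascade to
  \<open>S\<close> only adds saved nodes of \<open>misinformed_nodes G g Sr\<close>, and each of
  these contributes one set that meets \<open>S\<close>.\<close>

lemma x_cover_closer_nodes:
  assumes "finite (pverts G)"
  shows "x_cover (image_mset (closer_nodes g Sr) (mset_set (misinformed_nodes G g Sr))) S =
    real (card (never_misinformed G g Sr S)) - real (card (never_misinformed G g Sr {}))"
proof -
  let ?M = "misinformed_nodes G g Sr" and ?N = "never_misinformed G g Sr"
  have fin: "finite ?M" "finite (?N {})"
    using assms by (auto simp: misinformed_nodes_def never_misinformed_def)
  have empty: "?N {} = pverts G - ?M"
    by (auto simp: misinformed_nodes_def never_misinformed_def)
  have "?N {} \<subseteq> ?N S"
  proof
    fix v assume v: "v \<in> ?N {}"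
    then have "\<not> (\<exists>t. fst (diffusion g Sr {} t) v = Misinformed)"
      by (simp add: never_misinformed_def)
    then have "\<not> (\<exists>t. fst (diffusion g Sr S t) v = Misinformed)"
      unfolding misinformed_iff by simp
    with v show "v \<in> ?N S" by (simp add: never_misinformed_def)
  qed
  moreover have "?N S \<subseteq> pverts G" by (auto simp: never_misinformed_def)
  ultimately have S: "?N S = ?N {} \<union> {v \<in> ?M. v \<in> ?N S}" using empty by blast
  have "card (?N S) = card (?N {}) + card {v \<in> ?M. v \<in> ?N S}"
    by (subst S, subst card_Un_disjoint) (use fin empty in auto)
  moreover have "x_cover (image_mset (closer_nodes g Sr) (mset_set ?M)) S =
      (\<Sum>v\<in>?M. y_ind (closer_nodes g Sr v) S)"
    by (simp add: x_cover_def sum_unfold_sum_mset multiset.map_comp comp_def)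
  moreover have "\<dots> = (\<Sum>v\<in>?M. if v \<in> ?N S then 1 else 0)"
    by (rule sum.cong) (auto simp: y_ind_def never_misinformed_iff_closer_nodes)
  moreover have "\<dots> = real (card {v \<in> ?M. v \<in> ?N S})"
    using fin(1) by (simp add: sum.If_cases Int_def)
  ultimately show ?thesis by simp
qed

section \<open>Deferred sampling\<close>

lemma sample_edges_map_le:
  assumes "m' \<in> set_spmf (sample_edges p D m)"
  shows "m \<subseteq>\<^sub>m m'" "D \<subseteq> dom m'"
  using set_sample_edges(1,2)[OF assms] by (simp_all add: map_le_def subsetI)

text \<open>Deferred decisions for a single call: edge states are independent, so the undecided
  edges may be drawn in two stages.\<close>

lemma sample_edges_bind_sample_edges:
  assumes "D \<subseteq> E" "finite E"
  shows "sample_edges p D m \<bind> sample_edges p E = sample_edges p E m"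
proof -
  let ?b = "\<lambda>e. bernoulli_pmf (p e)"
  \<comment> \<open>\<open>D1\<close> holds the edges drawn by the first call, \<open>D2\<close>
    those left to the second.\<close>
  define D1 D2 where "D1 = D - dom m" and "D2 = E - dom m - D"
  have fin: "finite D1" "finite D2" and disj: "D1 \<inter> D2 = {}" and un: "E - dom m = D1 \<union> D2"
    using assms by (auto simp: D1_def D2_def intro: finite_subset)
  define ext where "ext m1 A s = (\<lambda>e. if e \<in> A then Some (s e) else m1 e)"
    for m1 :: "'a edge_states" and A and s :: "'a \<times> 'a \<Rightarrow> bool"
  have sample: "sample_edges p A m1 =
      spmf_of_pmf (map_pmf (ext m1 (A - dom m1)) (Pi_pmf (A - dom m1) False ?b))" for A m1
    unfolding sample_edges_def ext_def ..
  have dom: "E - dom (ext m D1 s) = D2" for s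
    using assms(1) by (auto simp: ext_def D1_def D2_def dom_def split: if_splits)
  have ext2: "ext (ext m D1 s) D2 s' = ext m (D1 \<union> D2) (\<lambda>e. if e \<in> D1 then s e else s' e)"
    for s s' using disj by (auto simp: ext_def fun_eq_iff)
  have "sample_edges p D m \<bind> sample_edges p E = spmf_of_pmf
      (Pi_pmf D1 False ?b \<bind> (\<lambda>s. map_pmf (ext (ext m D1 s) D2) (Pi_pmf D2 False ?b)))"
    unfolding sample D1_def[symmetric]
    by (simp add: dom bind_spmf_of_pmf spmf_of_pmf_bind bind_map_pmf)
  also have "Pi_pmf D1 False ?b \<bind> (\<lambda>s. map_pmf (ext (ext m D1 s) D2) (Pi_pmf D2 False ?b)) =
      map_pmf (ext m (D1 \<union> D2)) (Pi_pmf (D1 \<union> D2) False ?b)"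
    by (subst Pi_pmf_union[OF fin disj])
      (simp add: ext2 pair_pmf_def map_pmf_def bind_assoc_pmf bind_return_pmf)
  also have "spmf_of_pmf \<dots> = sample_edges p E m"
    by (simp add: sample un)
  finally show ?thesis .
qed

text \<open>
  The law of a run \<open>X\<close> together with a full realization extending its final memory. For the loops
  below, \<open>\<le>\<close> in the order of subprobability distributions follows by fixed-point induction without
  any termination argument; losslessness turns it into equality.
\<close>

definition complete_run :: "('v \<times> 'v \<Rightarrow> real) \<Rightarrow> ('v \<times> 'v) set \<Rightarrow> ('r \<times> 'v edge_states) spmf \<Rightarrow>
    ('r \<times> 'v edge_states) spmf" where
  "complete_run p E X = X \<bind> (\<lambda>(r, m). map_spmf (Pair r) (sample_edges p E m))"

lemma complete_run_return [simp]:
  "complete_run p E (return_spmf (r, m)) = map_spmf (Pair r) (sample_edges p E m)"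
  by (simp add: complete_run_def)

lemma complete_run_bind:
  "complete_run p E (bind_spmf X h) = X \<bind> (\<lambda>x. complete_run p E (h x))"
  by (simp add: complete_run_def)

lemma lossless_complete_run [simp]:
  "lossless_spmf (complete_run p E X) \<longleftrightarrow> lossless_spmf X"
  by (auto simp: complete_run_def)

text \<open>Supplies the admissibility needed for fixed-point induction over the two loops.\<close>

lemma mcont_complete_run [cont_intro]:
  "mcont lub ord lub_spmf (ord_spmf (=)) X \<Longrightarrow>
   mcont lub ord lub_spmf (ord_spmf (=)) (\<lambda>f. complete_run p E (X f))"
  unfolding complete_run_def by (intro mcont_bind_spmf) simp_all

text \<open>Going up in the order only moves mass from divergence to proper outcomes, and
  \<open>X\<close> has no mass on divergence.\<close>

lemma ord_spmf_lossless_eq: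
  assumes "ord_spmf (=) X Y" "lossless_spmf X"
  shows "X = Y"
proof -
  have "pmf X None = 0" using assms(2) by (simp add: lossless_iff_pmf_None)
  \<comment> \<open>The empty chain discharges the chain premise carried by the two order facts used
    here.\<close>
  with ord_spmf_eqD_pmf_None[OF chain_empty assms(1)] have "pmf X None = pmf Y None"
    by (simp add: order_antisym)
  with chain_empty assms(1) show ?thesis by (rule ord_spmf_eq_pmf_None_eq)
qed

lemma ord_spmf_bind_cong:
  assumes "\<And>x. x \<in> set_spmf X \<Longrightarrow> ord_spmf (=) (f x) (h x)"
  shows "ord_spmf (=) (bind_spmf X f) (bind_spmf X h)"
proof -
  \<comment> \<open>Monotonicity of bind asks for the inequality at every point. Off the support, f
    can be replaced by the least element without changing the bind.\<close>
  let ?f = "\<lambda>x. if x \<in> set_spmf X then f x else return_pmf None"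
  have "ord_spmf (=) (bind_spmf X ?f) (bind_spmf X h)"
    by (rule bind_spmf_mono') (simp_all add: assms)
  also have "bind_spmf X ?f = bind_spmf X f"
    by (rule bind_spmf_cong) simp_all
  finally show ?thesis .
qed

section \<open>The forward step\<close>

text \<open>A round inspects only arcs from newly active to inactive nodes. These are all decided in
  \<open>m\<close>, hence have the same state in every extension \<open>M\<close>.\<close>

lemma diffusion_step_sampled:
  assumes m: "m \<subseteq>\<^sub>m M" "{(u, v) \<in> E. u \<in> snd c \<and> fst c v = Inactive} \<subseteq> dom m"
    and "live_edges M \<subseteq> E"
  shows "diffusion_step (live_edges m) c = diffusion_step (live_edges M) c"
proof -
  obtain st N where c: "c = (st, N)" by force
  have edge: "(u, v) \<in> live_edges m \<longleftrightarrow> (u, v) \<in> live_edges M"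
    if "u \<in> N" "st v = Inactive" for u v
  proof
    assume "(u, v) \<in> live_edges m"
    then show "(u, v) \<in> live_edges M"
      using m(1) by (force simp: live_edges_def map_le_def)
  next
    assume l: "(u, v) \<in> live_edges M"
    then have "(u, v) \<in> dom m" using that assms(2,3) by (auto simp: c)
    with l m(1) show "(u, v) \<in> live_edges m"
      by (auto simp: live_edges_def map_le_def)
  qed
  have "{v. st v = Inactive \<and> (\<exists>u\<in>N. (u, v) \<in> live_edges m)} =
      {v. st v = Inactive \<and> (\<exists>u\<in>N. (u, v) \<in> live_edges M)}"
    using edge by blast
  then show ?thesis
    unfolding c diffusion_step.simps Let_def using edge by (auto simp: fun_eq_iff)
qed

text \<open>The second assumption is the loop invariant: under every extension of the memory, the
  diffusion passes through \<open>c\<close> at some time. It speaks of all extensions because the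
  memory is only partial.\<close>

lemma forward_loop_le:
  assumes fin: "finite (parcs G)"
    and "\<And>M. m \<subseteq>\<^sub>m M \<Longrightarrow> live_edges M \<subseteq> parcs G \<Longrightarrow> \<exists>t. c = diffusion (live_edges M) Sr {} t"
    and "live_edges m \<subseteq> parcs G"
  shows "ord_spmf (=) (complete_run p (parcs G) (forward_loop G p c m))
    (map_spmf (\<lambda>M. (misinformed_nodes G (live_edges M) Sr, M)) (sample_edges p (parcs G) m))"
  using assms
proof (induction arbitrary: c m rule: forward_loop.fixp_induct)
  case 1
  show ?case by (simp add: curry_def)
next
  case 2
  then show ?case by (simp add: complete_run_def)
next
  case (3 loop)
  show ?case
  proof (cases "snd c = {}")
    case True
    have "map_spmf (Pair {v \<in> pverts G. fst c v = Misinformed}) (sample_edges p (parcs G) m) =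
      map_spmf (\<lambda>M. (misinformed_nodes G (live_edges M) Sr, M)) (sample_edges p (parcs G) m)"
    proof (rule map_spmf_cong[OF refl])
      fix M assume M: "M \<in> set_spmf (sample_edges p (parcs G) m)"
      have "live_edges M \<subseteq> parcs G"
        by (rule live_edges_sample_subset[OF M order_refl 3(4)])
      then obtain t where "c = diffusion (live_edges M) Sr {} t"
        using 3(3) sample_edges_map_le(1)[OF M] by blast
      with True show "({v \<in> pverts G. fst c v = Misinformed}, M) =
          (misinformed_nodes G (live_edges M) Sr, M)"
        by (simp add: misinformed_nodes_eq)
    qed
    with True show ?thesis by simp
  next
    case False
    define D where "D = {(u, v) \<in> parcs G. u \<in> snd c \<and> fst c v = Inactive}"
    have D: "D \<subseteq> parcs G" by (auto simp: D_def)
    let ?F = "map_spmf (\<lambda>M. (misinformed_nodes G (live_edges M) Sr, M))"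
    have "ord_spmf (=)
        (complete_run p (parcs G) (loop G p (diffusion_step (live_edges m') c) m'))
        (?F (sample_edges p (parcs G) m'))"
      if m': "m' \<in> set_spmf (sample_edges p D m)" for m'
    proof (rule 3(1)[OF fin])
      show "live_edges m' \<subseteq> parcs G"
        by (rule live_edges_sample_subset[OF m' D 3(4)])
      fix M assume M: "m' \<subseteq>\<^sub>m M" "live_edges M \<subseteq> parcs G"
      then obtain t where t: "c = diffusion (live_edges M) Sr {} t"
        using 3(3) sample_edges_map_le(1)[OF m'] map_le_trans by blast
      have "diffusion_step (live_edges m') c = diffusion_step (live_edges M) c"
        using M sample_edges_map_le(2)[OF m'] by (intro diffusion_step_sampled) (auto simp: D_def)
      also have "\<dots> = diffusion (live_edges M) Sr {} (Suc t)"
        by (simp add: t diffusion_def)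
      finally show "\<exists>t. diffusion_step (live_edges m') c = diffusion (live_edges M) Sr {} t" ..
    qed
    then have "ord_spmf (=)
        (sample_edges p D m \<bind>
          (\<lambda>m'. complete_run p (parcs G) (loop G p (diffusion_step (live_edges m') c) m')))
        (sample_edges p D m \<bind> (\<lambda>m'. ?F (sample_edges p (parcs G) m')))"
      by (rule ord_spmf_bind_cong)
    \<comment> \<open>The draw of this round and the completing draw merge into one draw from
      \<open>m\<close>.\<close>
    also have "sample_edges p D m \<bind> (\<lambda>m'. ?F (sample_edges p (parcs G) m')) =
        ?F (sample_edges p (parcs G) m)"
      unfolding sample_edges_bind_sample_edges[OF D fin, symmetric, of p m]
      by (simp add: map_spmf_bind_spmf comp_def)
    finally show ?thesis
      using False by (simp add: complete_run_bind D_def)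
  qed
qed

lemma complete_run_forward_sample:
  assumes G: "pair_fin_digraph G"
  shows "complete_run p (parcs G) (forward_sample G p Sr) =
    map_spmf (\<lambda>M. (misinformed_nodes G (live_edges M) Sr, M))
      (sample_edges p (parcs G) Map.empty)"
proof (rule ord_spmf_lossless_eq)
  interpret pair_fin_digraph G by (rule G)
  show "ord_spmf (=) (complete_run p (parcs G) (forward_sample G p Sr))
    (map_spmf (\<lambda>M. (misinformed_nodes G (live_edges M) Sr, M))
      (sample_edges p (parcs G) Map.empty))"
    unfolding forward_sample_def
  proof (rule forward_loop_le)
    show "\<exists>t. initial_configuration Sr {} = diffusion (live_edges M) Sr {} t" for M
      by (rule exI[of _ 0]) (simp add: diffusion_def)
  qed (auto simp: live_edges_def)
  show "lossless_spmf (complete_run p (parcs G) (forward_sample G p Sr))"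
    using forward_loop_terminates[OF G, of Map.empty "initial_configuration Sr {}" Sr p]
    by (auto simp: forward_sample_def live_edges_def initial_configuration_def)
qed

section \<open>The reverse step\<close>

text \<open>The strict bound makes the ball of radius 0 empty, like the initial \<open>P\<close>, so
  that k counts the completed rounds.\<close>

definition reverse_ball :: "('v \<times> 'v) set \<Rightarrow> 'v \<Rightarrow> nat \<Rightarrow> 'v set" where
  "reverse_ball g v k = {u. \<exists>n<k. (u, v) \<in> g ^^ n}"

text \<open>The invariant of the reverse loop: \<open>Q\<close> is the layer of nodes at distance
  exactly k to v, and no node of \<open>Sr\<close> is closer than k.\<close>

definition reverse_state ::
  "('v \<times> 'v) set \<Rightarrow> 'v set \<Rightarrow> 'v \<Rightarrow> 'v set \<Rightarrow> 'v set \<Rightarrow> bool" where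
  "reverse_state g Sr v Q P \<longleftrightarrow> P \<inter> Sr = {} \<and>
     (\<exists>k. P = reverse_ball g v k \<and> Q = reverse_ball g v (Suc k) - reverse_ball g v k)"

lemma reverse_state_init: "reverse_state g Sr v {v} {}"
  by (auto simp: reverse_state_def reverse_ball_def intro!: exI[of _ 0])

text \<open>A frontier that meets \<open>Sr\<close> puts \<open>Sr\<close> at distance exactly k, so
  the ball \<open>P\<close> consists of the strictly closer nodes.\<close>

lemma reverse_state_stop:
  assumes "reverse_state g Sr v Q P" "Q \<inter> Sr \<noteq> {}"
  shows "P = closer_nodes g Sr v"
proof -
  obtain k where k: "P = reverse_ball g v k" "Q = reverse_ball g v (Suc k) - reverse_ball g v k"
    and P: "P \<inter> Sr = {}"
    using assms(1) by (auto simp: reverse_state_def)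
  have far: "v \<notin> (g ^^ j) `` Sr" if "j < k" for j
    using P that by (auto simp: k reverse_ball_def)
  have at: "v \<in> (g ^^ k) `` Sr"
    using assms(2) by (auto simp: k reverse_ball_def less_Suc_eq)
  show ?thesis
  proof (intro set_eqI iffI)
    fix u assume "u \<in> P"
    then obtain n where n: "n < k" "(u, v) \<in> g ^^ n" by (auto simp: k reverse_ball_def)
    have "\<forall>j\<le>n. v \<notin> (g ^^ j) `` Sr" using far n(1) by (meson order_le_less_trans)
    with n(2) show "u \<in> closer_nodes g Sr v" unfolding closer_nodes_def by blast
  next
    fix u assume "u \<in> closer_nodes g Sr v"
    then obtain n where "(u, v) \<in> g ^^ n" "\<forall>j\<le>n. v \<notin> (g ^^ j) `` Sr"
      by (auto simp: closer_nodes_def)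
    moreover with at have "n < k" using not_le_imp_less by blast
    ultimately show "u \<in> P" by (auto simp: k reverse_ball_def)
  qed
qed

lemma reverse_state_step:
  assumes "reverse_state g Sr v Q P" "Q \<inter> Sr = {}"
  shows "reverse_state g Sr v {u1. u1 \<notin> P \<union> Q \<and> (\<exists>u2\<in>Q. (u1, u2) \<in> g)} (P \<union> Q)"
proof -
  obtain k where k: "P = reverse_ball g v k" "Q = reverse_ball g v (Suc k) - reverse_ball g v k"
    and P: "P \<inter> Sr = {}"
    using assms(1) by (auto simp: reverse_state_def)
  \<comment> \<open>The search extends walks at their source, whereas \<open>relpow\<close> splits
    off the last arc.\<close>
  have rel: "(u, v) \<in> g ^^ Suc n \<longleftrightarrow> (\<exists>w. (u, w) \<in> g \<and> (w, v) \<in> g ^^ n)" for u n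
    by (auto simp: relpow_commute[symmetric])
  have PQ: "P \<union> Q = reverse_ball g v (Suc k)"
    by (auto simp: k reverse_ball_def less_Suc_eq)
  have "{u1. u1 \<notin> P \<union> Q \<and> (\<exists>u2\<in>Q. (u1, u2) \<in> g)} =
      reverse_ball g v (Suc (Suc k)) - reverse_ball g v (Suc k)" (is "?L = ?R")
  proof (intro set_eqI iffI)
    fix u assume "u \<in> ?L"
    then obtain w where u: "u \<notin> P \<union> Q" and w: "w \<in> Q" "(u, w) \<in> g" by blast
    then obtain n where "n < Suc k" "(w, v) \<in> g ^^ n" by (auto simp: k reverse_ball_def)
    then have "Suc n < Suc (Suc k)" "(u, v) \<in> g ^^ Suc n" using w(2) rel by blast+
    then have "u \<in> reverse_ball g v (Suc (Suc k))" unfolding reverse_ball_def by blast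
    with u show "u \<in> ?R" by (simp add: PQ)
  next
    fix u assume u: "u \<in> ?R"
    then have "(u, v) \<in> g ^^ Suc k" by (auto simp: reverse_ball_def less_Suc_eq)
    then obtain w where w: "(u, w) \<in> g" "(w, v) \<in> g ^^ k" by (auto simp only: rel)
    \<comment> \<open>If w were closer than k, u would already lie in
      \<open>P \<union> Q\<close>.\<close>
    have "w \<notin> reverse_ball g v k"
    proof
      assume "w \<in> reverse_ball g v k"
      then obtain n where "n < k" "(w, v) \<in> g ^^ n" by (auto simp: reverse_ball_def)
      with w(1) have "(u, v) \<in> g ^^ Suc n" "Suc n < Suc k" using rel by blast+
      with u show False unfolding reverse_ball_def by blast
    qed
    then have "w \<in> Q" using w(2) by (auto simp: k reverse_ball_def)
    with u w(1) show "u \<in> ?L" by (auto simp: PQ)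
  qed
  with PQ have "\<exists>j. P \<union> Q = reverse_ball g v j \<and>
      ?L = reverse_ball g v (Suc j) - reverse_ball g v j" by blast
  moreover have "(P \<union> Q) \<inter> Sr = {}" using P assms(2) by blast
  ultimately show ?thesis by (simp only: reverse_state_def simp_thms)
qed

text \<open>As in the forward step, the invariant is required under every extension of the memory;
  the arcs in \<open>D\<close> are all that the next frontier depends on.\<close>

lemma reverse_loop_le:
  assumes G: "pair_fin_digraph G"
    and "\<And>M. m \<subseteq>\<^sub>m M \<Longrightarrow> live_edges M \<subseteq> parcs G \<Longrightarrow> reverse_state (live_edges M) Sr v Q P"
    and "live_edges m \<subseteq> parcs G"
  shows "ord_spmf (=) (complete_run p (parcs G) (reverse_loop G p Sr Q P m))
    (map_spmf (\<lambda>M. (closer_nodes (live_edges M) Sr v, M)) (sample_edges p (parcs G) m))"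
  using assms
proof (induction arbitrary: Q P m rule: reverse_loop.fixp_induct)
  case 1
  show ?case by (simp add: curry_def)
next
  case 2
  then show ?case by (simp add: complete_run_def)
next
  case (3 loop)
  interpret pair_fin_digraph G by (rule G)
  let ?F = "map_spmf (\<lambda>M. (closer_nodes (live_edges M) Sr v, M))"
  show ?case
  proof (cases "Q \<inter> Sr = {}")
    case False
    have "map_spmf (Pair P) (sample_edges p (parcs G) m) = ?F (sample_edges p (parcs G) m)"
    proof (rule map_spmf_cong[OF refl])
      fix M assume M: "M \<in> set_spmf (sample_edges p (parcs G) m)"
      have "live_edges M \<subseteq> parcs G"
        by (rule live_edges_sample_subset[OF M order_refl 3(4)])
      then have "reverse_state (live_edges M) Sr v Q P"
        using 3(3) sample_edges_map_le(1)[OF M] by blast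
      from reverse_state_stop[OF this False] show "(P, M) = (closer_nodes (live_edges M) Sr v, M)"
        by simp
    qed
    with False show ?thesis by simp
  next
    case True
    define D where "D = {(u1, u2) \<in> parcs G. u2 \<in> Q \<and> u1 \<in> pverts G - (P \<union> Q)}"
    define Q' where "Q' m' = {u1. \<exists>u2. (u1, u2) \<in> D \<and> (u1, u2) \<in> live_edges m'}" for m'
    have D: "D \<subseteq> parcs G" by (auto simp: D_def)
    have "ord_spmf (=) (complete_run p (parcs G) (loop G p Sr (Q' m') (P \<union> Q) m'))
        (?F (sample_edges p (parcs G) m'))"
      if m': "m' \<in> set_spmf (sample_edges p D m)" for m'
    proof (rule 3(1)[OF G])
      show "live_edges m' \<subseteq> parcs G"
        by (rule live_edges_sample_subset[OF m' D 3(4)])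
      fix M assume M: "m' \<subseteq>\<^sub>m M" "live_edges M \<subseteq> parcs G"
      then have state: "reverse_state (live_edges M) Sr v Q P"
        using 3(3) sample_edges_map_le(1)[OF m'] map_le_trans by blast
      have "e \<in> live_edges m' \<longleftrightarrow> e \<in> live_edges M" if "e \<in> D" for e
        using subsetD[OF sample_edges_map_le(2)[OF m'] that] M(1)
        by (simp add: live_edges_def map_le_def)
      then have "Q' m' = {u1. \<exists>u2. (u1, u2) \<in> D \<and> (u1, u2) \<in> live_edges M}"
        by (auto simp: Q'_def)
      \<comment> \<open>Live arcs of \<open>M\<close> are arcs of \<open>G\<close>, whose tails are
        vertices, so the vertex restriction in \<open>D\<close> loses no predecessor.\<close>
      also have "\<dots> = {u1. u1 \<notin> P \<union> Q \<and> (\<exists>u2\<in>Q. (u1, u2) \<in> live_edges M)}"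
        using M(2) by (auto simp: D_def dest: in_arcsD1)
      finally show "reverse_state (live_edges M) Sr v (Q' m') (P \<union> Q)"
        using reverse_state_step[OF state True] by simp
    qed
    then have "ord_spmf (=)
        (sample_edges p D m \<bind>
          (\<lambda>m'. complete_run p (parcs G) (loop G p Sr (Q' m') (P \<union> Q) m')))
        (sample_edges p D m \<bind> (\<lambda>m'. ?F (sample_edges p (parcs G) m')))"
      by (rule ord_spmf_bind_cong)
    also have "sample_edges p D m \<bind> (\<lambda>m'. ?F (sample_edges p (parcs G) m')) =
        ?F (sample_edges p (parcs G) m)"
      unfolding sample_edges_bind_sample_edges[OF D pair_finite_arcs, symmetric, of p m]
      by (simp add: map_spmf_bind_spmf comp_def)
    finally show ?thesis
      using True by (simp add: complete_run_bind D_def Q'_def Let_def)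
  qed
qed

text \<open>The loop diverges once its frontier is empty. A walk of known live arcs from
  \<open>Sr\<close> to v rules this out and makes the run lossless.\<close>

lemma complete_run_reverse_loop:
  assumes G: "pair_fin_digraph G" and "v \<in> pverts G" "live_edges m \<subseteq> parcs G"
    "v \<in> (live_edges m)\<^sup>* `` Sr"
  shows "complete_run p (parcs G) (reverse_loop G p Sr {v} {} m) =
    map_spmf (\<lambda>M. (closer_nodes (live_edges M) Sr v, M)) (sample_edges p (parcs G) m)"
proof (rule ord_spmf_lossless_eq)
  show "ord_spmf (=) (complete_run p (parcs G) (reverse_loop G p Sr {v} {} m))
    (map_spmf (\<lambda>M. (closer_nodes (live_edges M) Sr v, M)) (sample_edges p (parcs G) m))"
    by (rule reverse_loop_le[OF G]) (simp_all add: reverse_state_init assms)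
  show "lossless_spmf (complete_run p (parcs G) (reverse_loop G p Sr {v} {} m))"
    using reverse_loop_terminates[OF G, of v m Sr "{}" "{v}" p] assms by simp
qed

text \<open>Successive reverse runs share edge states, so their sets are dependent; one common
  completion \<open>M\<close> determines all of them.\<close>

lemma reverse_samples_eq:
  assumes G: "pair_fin_digraph G"
  shows "live_edges m \<subseteq> parcs G \<Longrightarrow> set vs \<subseteq> pverts G \<Longrightarrow>
    set vs \<subseteq> (live_edges m)\<^sup>* `` Sr \<Longrightarrow>
    reverse_samples G p Sr vs m =
      map_spmf (\<lambda>M. image_mset (closer_nodes (live_edges M) Sr) (mset vs))
        (sample_edges p (parcs G) m)"
proof (induction vs arbitrary: m)
  case Nil
  show ?case by (simp add: sample_edges_def map_pmf_const)
next
  case (Cons v vs)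
  let ?E = "parcs G"
  let ?R = "\<lambda>M. image_mset (closer_nodes (live_edges M) Sr)"
  have rl: "\<forall>(A, m') \<in> set_spmf (reverse_loop G p Sr {v} {} m).
       live_edges m' \<subseteq> ?E \<and> live_edges m \<subseteq> live_edges m'"
    using Cons.prems by (intro conjunct2[OF reverse_loop_terminates[OF G, of v]]) auto
  have "reverse_samples G p Sr (v # vs) m =
      reverse_loop G p Sr {v} {} m \<bind>
        (\<lambda>(P, m'). map_spmf (add_mset P) (reverse_samples G p Sr vs m'))"
    by (simp add: map_spmf_conv_bind_spmf)
  \<comment> \<open>The induction hypothesis applies to the new memory because live edges only
    accumulate, which preserves reachability from \<open>Sr\<close>.\<close>
  also have "\<dots> = reverse_loop G p Sr {v} {} m \<bind>
        (\<lambda>(P, m'). map_spmf (\<lambda>M. add_mset P (?R M (mset vs))) (sample_edges p ?E m'))"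
  proof (rule bind_spmf_cong[OF refl], clarify)
    fix P m' assume "(P, m') \<in> set_spmf (reverse_loop G p Sr {v} {} m)"
    then have *: "live_edges m' \<subseteq> ?E" "live_edges m \<subseteq> live_edges m'" using rl by auto
    have "set vs \<subseteq> (live_edges m)\<^sup>* `` Sr" using Cons.prems(3) by simp
    also have "\<dots> \<subseteq> (live_edges m')\<^sup>* `` Sr"
      using rtrancl_mono[OF *(2)] by (rule Image_mono) simp
    finally have "reverse_samples G p Sr vs m' =
        map_spmf (\<lambda>M. ?R M (mset vs)) (sample_edges p ?E m')"
      using Cons.prems(2) *(1) by (intro Cons.IH) simp_all
    then show "map_spmf (add_mset P) (reverse_samples G p Sr vs m') =
        map_spmf (\<lambda>M. add_mset P (?R M (mset vs))) (sample_edges p ?E m')"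
      by (simp add: spmf.map_comp comp_def)
  qed
  also have "\<dots> = map_spmf (\<lambda>(P, M). add_mset P (?R M (mset vs)))
      (complete_run p ?E (reverse_loop G p Sr {v} {} m))"
    by (simp add: complete_run_def map_spmf_bind_spmf spmf.map_comp comp_def case_prod_unfold)
  also have "\<dots> = map_spmf (\<lambda>M. ?R M (mset (v # vs))) (sample_edges p ?E m)"
    using Cons.prems
    by (simp add: complete_run_reverse_loop[OF G] spmf.map_comp comp_def)
  finally show ?case .
qed

section \<open>The law of a whole R-sample\<close>

lemma r_sample_eq:
  assumes G: "pair_fin_digraph G" and ord: "processing_order G ord"
  shows "r_sample G p Sr ord = spmf_of_pmf
    (map_pmf (\<lambda>g. image_mset (closer_nodes g Sr) (mset_set (misinformed_nodes G g Sr)))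
      (realization_pmf G p))"
proof -
  let ?E = "parcs G"
  let ?R = "\<lambda>M A. image_mset (closer_nodes (live_edges M) Sr) (mset_set A)"
  have fwd: "\<forall>(A, m) \<in> set_spmf (forward_sample G p Sr).
       A \<subseteq> pverts G \<and> live_edges m \<subseteq> ?E \<and> A \<subseteq> (live_edges m)\<^sup>* `` Sr"
    unfolding forward_sample_def
    by (rule conjunct2[OF forward_loop_terminates[OF G]])
      (auto simp: live_edges_def initial_configuration_def)
  have "r_sample G p Sr ord = forward_sample G p Sr \<bind>
      (\<lambda>(A, m). map_spmf (\<lambda>M. ?R M A) (sample_edges p ?E m))"
    unfolding r_sample_def
  proof (rule bind_spmf_cong[OF refl], clarify)
    fix A m assume "(A, m) \<in> set_spmf (forward_sample G p Sr)"
    then have A: "A \<subseteq> pverts G" "live_edges m \<subseteq> ?E" "A \<subseteq> (live_edges m)\<^sup>* `` Sr"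
      using fwd by auto
    then have o: "set (ord A m) = A" "distinct (ord A m)"
      using ord by (simp_all add: processing_order_def)
    \<comment> \<open>The processing order disappears here, even if it depends on the
      memory.\<close>
    then have "mset_set A = mset (ord A m)" using mset_set_set by metis
    with A o show "reverse_samples G p Sr (ord A m) m =
        map_spmf (\<lambda>M. ?R M A) (sample_edges p ?E m)"
      by (simp add: reverse_samples_eq[OF G])
  qed
  also have "\<dots> = map_spmf (\<lambda>(A, M). ?R M A) (complete_run p ?E (forward_sample G p Sr))"
    by (simp add: complete_run_def map_spmf_bind_spmf spmf.map_comp comp_def case_prod_unfold)
  also have "\<dots> = map_spmf (\<lambda>M. ?R M (misinformed_nodes G (live_edges M) Sr))
      (sample_edges p ?E Map.empty)"
    by (simp add: complete_run_forward_sample[OF G] spmf.map_comp comp_def)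
  also have "\<dots> = spmf_of_pmf
    (map_pmf (\<lambda>g. image_mset (closer_nodes g Sr) (mset_set (misinformed_nodes G g Sr)))
      (realization_pmf G p))"
  proof -
    \<comment> \<open>Completing the empty memory amounts to drawing a full realization.\<close>
    have "live_edges (\<lambda>e. if e \<in> ?E - dom Map.empty then Some (s e) else None) = {e \<in> ?E. s e}"
      for s :: "'a \<times> 'a \<Rightarrow> bool"
      by (auto simp: live_edges_def)
    then show ?thesis
      by (simp only: sample_edges_def realization_pmf_def map_spmf_of_pmf pmf.map_comp comp_def)
        simp
  qed
  finally show ?thesis .
qed

theorem lemma2:
  fixes G :: "'v pair_pre_digraph" and p :: "'v \<times> 'v \<Rightarrow> real"
    and Sr S :: "'v set" and ord :: "'v set \<Rightarrow> 'v edge_states \<Rightarrow> 'v list"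
  assumes "pair_fin_digraph G"
    and "\<And>e. e \<in> parcs G \<Longrightarrow> 0 < p e \<and> p e \<le> 1"
    and "Sr \<subseteq> pverts G"
    and "processing_order G ord"
    and "S \<subseteq> pverts G"
  shows "(\<integral>Ps. x_cover Ps S \<partial>measure_spmf (r_sample G p Sr ord)) = f_star G p Sr S"
proof -
  interpret pair_fin_digraph G by (rule assms(1))
  \<comment> \<open>There are only finitely many realizations, so both cardinalities are integrable
    and the expectation of their difference splits.\<close>
  have "set_pmf (realization_pmf G p) \<subseteq> Pow (parcs G)"
    by (auto simp: realization_pmf_def)
  then have fin: "finite (set_pmf (realization_pmf G p))"
    by (rule finite_subset) simp
  have "(\<integral>Ps. x_cover Ps S \<partial>measure_spmf (r_sample G p Sr ord)) =
      measure_pmf.expectation (realization_pmf G p) (\<lambda>g.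
        real (card (never_misinformed G g Sr S)) - real (card (never_misinformed G g Sr {})))"
    by (simp add: r_sample_eq[OF assms(1,4)] x_cover_closer_nodes)
  also have "\<dots> = f_star G p Sr S"
    unfolding f_star_def f_val_def
    by (rule Bochner_Integration.integral_diff) (rule integrable_measure_pmf_finite[OF fin])+
  finally show ?thesis .
qed

end
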